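(* Assume $\mathfrak{b}>\omega_1$. Let $E_\alpha, F_\alpha$ ($\alpha<\omega_1$) be infinite subsets of $\omega$ such that $\{E_\alpha:\alpha<\omega_1\}\cup\{F_\alpha:\alpha<\omega_1\}$ is an almost disjoint family (distinct members, pairwise finite intersections). Then there exists a Hausdorff pre-gap $[\{A_\alpha:\alpha<\omega_1\};\{B_\alpha:\alpha<\omega_1\}]$ of subsets of $\omega$ such that for every $\alpha<\omega_1$: $E_\alpha\subseteq^* A_{\alpha+1}\setminus A_\alpha\subseteq^* E_\alpha$ and $F_\alpha\subseteq^* B_\alpha\setminus B_{\alpha+1}\subseteq^* F_\alpha$.
   Context: $\mathfrak{b}$ denotes the least cardinality of a family of functions $f:\omega\to\omega$ that is unbounded with respect to $\leq^*$, where $f\leq^* g$ means $f(n)\leq g(n)$ for all but finitely many $n$. $A\subseteq^* B$ means $A\setminus B$ is finite; $A\subset^* B$ means $A\subseteq^* B$ but not $B\subseteq^* A$. A pair of indexed families $[\{A_\alpha:\alpha<\omega_1\};\{B_\alpha:\alpha<\omega_1\}]$ is a Hausdorff pre-gap if $\alpha<\beta<\omega_1$ implies $A_\alpha\subset^* A_\beta\subset^* B_\beta\subset^* B_\alpha$. *)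

theory Defs
  imports Main
begin

unbundle cardinal_syntax

definition le_star :: "(nat \<Rightarrow> nat) \<Rightarrow> (nat \<Rightarrow> nat) \<Rightarrow> bool" (infix "\<le>\<^sup>*" 50)
  where "f \<le>\<^sup>* g \<longleftrightarrow> (\<forall>\<^sub>\<infinity>n. f n \<le> g n)"

definition unbounded_family :: "(nat \<Rightarrow> nat) set \<Rightarrow> bool"
  where "unbounded_family H \<longleftrightarrow> \<not> (\<exists>g. \<forall>f\<in>H. f \<le>\<^sup>* g)"

text \<open>
  Cardinals are represented, as in the library, by cardinal orders, and are compared with
  \<open>\<le>o\<close> and \<open><o\<close>. The choice is determined up to \<open>=o\<close>, and a least cardinal exists by
  the lemma following the definition.
\<close>

definition bounding_number :: "(nat \<Rightarrow> nat) rel"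
  where "bounding_number =
    (SOME r. r \<in> {|H| | H. unbounded_family H} \<and>
             (\<forall>r' \<in> {|H| | H. unbounded_family H}. r \<le>o r'))"

lemma bounding_number_least:
  shows "\<exists>H. unbounded_family H \<and> bounding_number = |H|"
    and "unbounded_family H \<Longrightarrow> bounding_number \<le>o |H|"
proof -
  let ?R = "{|H| | H. unbounded_family H}"
  have "\<not> f \<le>\<^sup>* g" if "f = (\<lambda>n. Suc (g n))" for f g
    unfolding le_star_def that by simp
  then have "unbounded_family UNIV"
    unfolding unbounded_family_def by blast
  then have "?R \<noteq> {}" by blast
  moreover have "\<forall>r\<in>?R. Card_order r"
    by (auto simp: card_of_Card_order)
  ultimately have "\<exists>r. r \<in> ?R \<and> (\<forall>r'\<in>?R. r \<le>o r')"
    using exists_minim_Card_order[of ?R] by blast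
  from someI_ex[OF this]
  have *: "bounding_number \<in> ?R" "\<forall>r'\<in>?R. bounding_number \<le>o r'"
    unfolding bounding_number_def by blast+
  show "\<exists>H. unbounded_family H \<and> bounding_number = |H|"
    using *(1) by blast
  show "unbounded_family H \<Longrightarrow> bounding_number \<le>o |H|"
    using *(2) by blast
qed

text \<open>
  The ordinal \<open>\<omega>\<^sub>1\<close> is the reflexive well-order \<open>omega1\<close>, the cardinal successor of
  \<open>\<omega>\<close>; the ordinals below \<open>\<omega>\<^sub>1\<close> are the elements of its field. The underlying type
  \<^typ>\<open>nat set\<close> comes from the library's cardinal successor and is only a carrier.
\<close>

definition omega1 :: "nat set rel"
  where "omega1 = cardSuc natLeq"

abbreviation \<Omega>\<^sub>1 :: "nat set set"
  where "\<Omega>\<^sub>1 \<equiv> Field omega1"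

definition less_omega1 :: "nat set \<Rightarrow> nat set \<Rightarrow> bool" (infix "\<prec>" 50)
  where "\<alpha> \<prec> \<beta> \<longleftrightarrow> (\<alpha>, \<beta>) \<in> omega1 \<and> \<alpha> \<noteq> \<beta>"

definition succ_omega1 :: "nat set \<Rightarrow> nat set"
  where "succ_omega1 \<alpha> = wo_rel.suc omega1 {\<alpha>}"

lemma wo_rel_omega1: "wo_rel omega1"
  by (metis omega1_def cardSuc_Card_order natLeq_Card_order card_order_on_well_order_on wo_rel_def)

lemma succ_omega1:
  assumes "\<alpha> \<in> \<Omega>\<^sub>1"
  shows "succ_omega1 \<alpha> \<in> \<Omega>\<^sub>1" "\<alpha> \<prec> succ_omega1 \<alpha>"
    and "\<alpha> \<prec> \<beta> \<Longrightarrow> succ_omega1 \<alpha> = \<beta> \<or> succ_omega1 \<alpha> \<prec> \<beta>"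
proof -
  have "infinite \<Omega>\<^sub>1"
    unfolding omega1_def
    using cardSuc_finite natLeq_Card_order Field_natLeq infinite_UNIV_nat by metis
  moreover have "Card_order omega1"
    unfolding omega1_def by (rule cardSuc_Card_order[OF natLeq_Card_order])
  ultimately obtain \<gamma> where "\<gamma> \<in> \<Omega>\<^sub>1" "\<alpha> \<noteq> \<gamma>" "(\<alpha>, \<gamma>) \<in> omega1"
    using infinite_Card_order_limit assms by metis
  then have ne: "AboveS omega1 {\<alpha>} \<noteq> {}"
    unfolding AboveS_def by auto
  have sub: "{\<alpha>} \<subseteq> \<Omega>\<^sub>1" using assms by simp
  show "succ_omega1 \<alpha> \<in> \<Omega>\<^sub>1"
    unfolding succ_omega1_def by (rule wo_rel.suc_inField[OF wo_rel_omega1 sub ne])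
  show "\<alpha> \<prec> succ_omega1 \<alpha>"
    unfolding succ_omega1_def less_omega1_def
    using wo_rel.suc_greater[OF wo_rel_omega1 sub ne] by auto
  show "succ_omega1 \<alpha> = \<beta> \<or> succ_omega1 \<alpha> \<prec> \<beta>" if "\<alpha> \<prec> \<beta>"
  proof -
    have "\<beta> \<in> AboveS omega1 {\<alpha>}"
      using that unfolding AboveS_def less_omega1_def by (auto simp: Field_def)
    then show ?thesis
      unfolding succ_omega1_def less_omega1_def
      using wo_rel.suc_least_AboveS[OF wo_rel_omega1] by blast
  qed
qed

definition almost_subset :: "nat set \<Rightarrow> nat set \<Rightarrow> bool" (infix "\<subseteq>\<^sup>*" 50)
  where "A \<subseteq>\<^sup>* B \<longleftrightarrow> finite (A - B)"

definition almost_psubset :: "nat set \<Rightarrow> nat set \<Rightarrow> bool" (infix "\<subset>\<^sup>*" 50)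
  where "A \<subset>\<^sup>* B \<longleftrightarrow> A \<subseteq>\<^sup>* B \<and> \<not> B \<subseteq>\<^sup>* A"

definition almost_disjoint_family :: "nat set set \<Rightarrow> bool"
  where "almost_disjoint_family \<A> \<longleftrightarrow>
    (\<forall>X\<in>\<A>. infinite X) \<and> pairwise (\<lambda>X Y. finite (X \<inter> Y)) \<A>"

definition hausdorff_pregap :: "(nat set \<Rightarrow> nat set) \<Rightarrow> (nat set \<Rightarrow> nat set) \<Rightarrow> bool"
  where "hausdorff_pregap A B \<longleftrightarrow>
    (\<forall>\<alpha>\<in>\<Omega>\<^sub>1. \<forall>\<beta>\<in>\<Omega>\<^sub>1. \<alpha> \<prec> \<beta> \<longrightarrow>
       A \<alpha> \<subset>\<^sup>* A \<beta> \<and> A \<beta> \<subset>\<^sup>* B \<beta> \<and> B \<beta> \<subset>\<^sup>* B \<alpha>)"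

end

theory Submission
  imports Defs
begin

text \<open>
  The pairs \<open>(A \<alpha>, B \<alpha>)\<close> are built by recursion, keeping every \<open>E \<gamma>\<close> and \<open>F \<gamma>\<close> with
  \<open>\<gamma> \<ge> \<alpha>\<close> almost disjoint from \<open>A \<alpha>\<close> and almost contained in \<open>B \<alpha>\<close>. At successors
  \<open>E \<alpha>\<close> is added to \<open>A \<alpha>\<close> and \<open>F \<alpha>\<close> is removed from \<open>B \<alpha>\<close>. At other stages the
  countably many earlier pairs are enumerated as \<open>(P n, Q n)\<close>, and the new pair consists of the
  union of the sets \<open>P n - {..<h n}\<close> and the complement of the union of the sets
  \<open>- Q n - {..<h n}\<close>. How large \<open>h\<close> must be for a given \<open>E \<gamma>\<close> or \<open>F \<gamma>\<close> is described by
  a function on \<open>\<omega>\<close>; as there are at most \<open>\<omega>\<^sub>1\<close> of these and \<open>\<bb> > \<omega>\<^sub>1\<close>, one \<open>h\<close>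
  eventually dominates all of them.
\<close>

section \<open>Interpolation between countably many pairs of sets\<close>

lemma almost_subset_trans [trans]: "X \<subseteq>\<^sup>* Y \<Longrightarrow> Y \<subseteq>\<^sup>* Z \<Longrightarrow> X \<subseteq>\<^sup>* Z"
  unfolding almost_subset_def by (rule finite_subset[of _ "(X - Y) \<union> (Y - Z)"]) auto

lemma bounded_family_if_card_less:
  assumes "|H| <o bounding_number"
  obtains g where "\<And>f. f \<in> H \<Longrightarrow> f \<le>\<^sup>* g"
proof -
  have "\<not> unbounded_family H"
    using assms bounding_number_least(2) not_ordLess_ordLeq by blast
  then show thesis
    unfolding unbounded_family_def using that by blast
qed

text \<open>For each \<open>X\<close> the finite sets \<open>X \<inter> P n\<close> and
  \<open>X - Q n\<close> are bounded by a function of \<open>n\<close>, and fewer than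
  \<open>bounding_number\<close> such functions have a common eventual bound. Cutting
  \<open>P n\<close> and \<open>- Q n\<close> off at this bound leaves only finitely many
  \<open>n\<close> at which \<open>X\<close> is affected. A second bound turns the almost inclusions
  into \<open>A \<subseteq> B\<close>.\<close>

lemma bounding_number_interpolation:
  fixes P Q :: "nat \<Rightarrow> nat set"
  assumes card: "|\<X>| <o bounding_number"
    and PQ: "\<And>m n. P m \<subseteq>\<^sup>* Q n"
    and XP: "\<And>X n. X \<in> \<X> \<Longrightarrow> finite (X \<inter> P n)"
    and XQ: "\<And>X n. X \<in> \<X> \<Longrightarrow> X \<subseteq>\<^sup>* Q n"
  obtains A B where "\<And>n. P n \<subseteq>\<^sup>* A" "A \<subseteq> B" "\<And>n. B \<subseteq>\<^sup>* Q n"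
    "\<And>X. X \<in> \<X> \<Longrightarrow> finite (X \<inter> A)" "\<And>X. X \<in> \<X> \<Longrightarrow> X \<subseteq>\<^sup>* B"
proof -
  have "\<exists>f. \<forall>n. \<forall>x \<in> (X \<inter> P n) \<union> (X - Q n). x < f n" if "X \<in> \<X>" for X
    using XP[OF that] XQ[OF that]
    unfolding almost_subset_def by (intro choice) (meson finite_Un finite_nat_set_iff_bounded)
  then obtain f where f: "\<And>X n x. X \<in> \<X> \<Longrightarrow> x \<in> (X \<inter> P n) \<union> (X - Q n) \<Longrightarrow> x < f X n"
    by metis
  have "|f ` \<X>| <o bounding_number"
    using card card_of_image ordLeq_ordLess_trans by blast
  then obtain g where g: "\<And>X. X \<in> \<X> \<Longrightarrow> f X \<le>\<^sup>* g"
    using bounded_family_if_card_less by (metis imageI)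
  \<comment> \<open>Restricting to \<open>m \<le> n\<close> keeps the union finite. As both
    differences are included, a point of \<open>P m - Q n\<close> lies below \<open>h\<close> at the
    larger of the two indices, whatever their order.\<close>
  have "finite (\<Union>m\<le>n. (P m - Q n) \<union> (P n - Q m))" for n
    using PQ unfolding almost_subset_def by auto
  then have "\<exists>h. \<forall>n. \<forall>x \<in> (\<Union>m\<le>n. (P m - Q n) \<union> (P n - Q m)). x < h n"
    by (intro choice) (meson finite_nat_set_iff_bounded)
  then obtain h where h: "\<And>m n x. m \<le> n \<Longrightarrow> x \<in> (P m - Q n) \<union> (P n - Q m) \<Longrightarrow> x < h n"
    by (metis UN_I atMost_iff)
  define k where "k n = max (g n) (h n)" for n
  define A where "A = (\<Union>n. P n - {..<k n})"
  define B where "B = - (\<Union>n. - Q n - {..<k n})"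
  show thesis
  proof
    show "P n \<subseteq>\<^sup>* A" for n
      unfolding almost_subset_def A_def by (rule finite_subset[of _ "{..<k n}"]) auto
    show "B \<subseteq>\<^sup>* Q n" for n
      unfolding almost_subset_def B_def by (rule finite_subset[of _ "{..<k n}"]) auto
    show "A \<subseteq> B"
    proof
      fix x assume "x \<in> A"
      then obtain m where m: "x \<in> P m" "k m \<le> x"
        unfolding A_def by auto
      have "x \<in> Q n" if "k n \<le> x" for n
        using h[of m n x] h[of n m x] m that unfolding k_def by (cases "m \<le> n") auto
      then show "x \<in> B"
        unfolding B_def by force
    qed
    fix X assume X: "X \<in> \<X>"
    then obtain N where N: "\<And>n. n \<ge> N \<Longrightarrow> f X n \<le> g n"
      using g unfolding le_star_def cofinite_eq_sequentially eventually_sequentially by blast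
    \<comment> \<open>From \<open>N\<close> on, \<open>k n\<close> is at least \<open>f X n\<close>,
      so no point of \<open>X\<close> in \<open>P n\<close> or outside \<open>Q n\<close> survives
      the cutoff.\<close>
    have small: "n < N" if "x \<in> (X \<inter> P n) \<union> (X - Q n)" "k n \<le> x" for x n
      using f[OF X that(1)] that(2) N[of n] unfolding k_def by force
    have "X \<inter> A \<subseteq> (\<Union>n<N. X \<inter> P n)"
      using small unfolding A_def by force
    then show "finite (X \<inter> A)"
      by (rule finite_subset) (use XP[OF X] in blast)
    have "X - B \<subseteq> (\<Union>n<N. X - Q n)"
      using small unfolding B_def by force
    then show "X \<subseteq>\<^sup>* B"
      unfolding almost_subset_def
      by (rule finite_subset) (use XQ[OF X, unfolded almost_subset_def] in blast)
  qed
qed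

section \<open>Cardinality and order of \<open>omega1\<close>\<close>

lemma Card_order_omega1: "Card_order omega1"
  unfolding omega1_def by (rule cardSuc_Card_order[OF natLeq_Card_order])

lemma card_image_Omega1: "|f ` \<Omega>\<^sub>1| \<le>o omega1"
  by (rule ordLeq_ordIso_trans[OF card_of_image card_of_Field_ordIso[OF Card_order_omega1]])

text \<open>A cardinal below the successor of \<open>natLeq\<close> is at most
  \<open>natLeq\<close>. This is what lets the earlier pairs be enumerated by natural
  numbers.\<close>

lemma less_omega1_countable:
  assumes "\<alpha> \<in> \<Omega>\<^sub>1"
  shows "|{\<beta>. \<beta> \<prec> \<alpha>}| \<le>o |UNIV :: nat set|"
proof -
  have "|underS omega1 \<alpha>| <o cardSuc natLeq"
    using card_of_underS[OF Card_order_omega1 assms] unfolding omega1_def .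
  then have "|underS omega1 \<alpha>| \<le>o natLeq"
    using cardSuc_ordLeq_ordLess[OF natLeq_Card_order card_of_Card_order] by blast
  moreover have "underS omega1 \<alpha> = {\<beta>. \<beta> \<prec> \<alpha>}"
    unfolding underS_def less_omega1_def by blast
  ultimately show ?thesis
    using card_of_nat ordIso_symmetric ordLeq_ordIso_trans by metis
qed

lemma wf_less_omega1: "wf {(\<alpha>, \<beta>). \<alpha> \<prec> \<beta>}"
proof -
  have "{(\<alpha>, \<beta>). \<alpha> \<prec> \<beta>} = omega1 - Id"
    unfolding less_omega1_def by blast
  then show ?thesis
    using wo_rel.WF[OF wo_rel_omega1] by simp
qed

lemma less_omega1_Field: "\<alpha> \<prec> \<beta> \<Longrightarrow> \<alpha> \<in> \<Omega>\<^sub>1" "\<alpha> \<prec> \<beta> \<Longrightarrow> \<beta> \<in> \<Omega>\<^sub>1"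
  unfolding less_omega1_def Field_def by auto

lemma less_omega1_trans [trans]: "\<alpha> \<prec> \<beta> \<Longrightarrow> \<beta> \<prec> \<gamma> \<Longrightarrow> \<alpha> \<prec> \<gamma>"
  using wo_rel.TRANS[OF wo_rel_omega1] wo_rel.ANTISYM[OF wo_rel_omega1]
  unfolding less_omega1_def by (metis antisymD transD)

lemma less_omega1_irrefl: "\<not> \<alpha> \<prec> \<alpha>"
  unfolding less_omega1_def by blast

lemma less_omega1_linear: "\<alpha> \<in> \<Omega>\<^sub>1 \<Longrightarrow> \<beta> \<in> \<Omega>\<^sub>1 \<Longrightarrow> \<alpha> \<prec> \<beta> \<or> \<alpha> = \<beta> \<or> \<beta> \<prec> \<alpha>"
  using wo_rel.TOTALS[OF wo_rel_omega1] unfolding less_omega1_def by blast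

lemma less_succ_omega1_iff:
  assumes "\<beta> \<in> \<Omega>\<^sub>1"
  shows "\<alpha> \<prec> succ_omega1 \<beta> \<longleftrightarrow> \<alpha> \<prec> \<beta> \<or> \<alpha> = \<beta>"
proof
  assume *: "\<alpha> \<prec> succ_omega1 \<beta>"
  then have "\<not> \<beta> \<prec> \<alpha>"
    using succ_omega1(3)[OF assms] less_omega1_trans less_omega1_irrefl by metis
  then show "\<alpha> \<prec> \<beta> \<or> \<alpha> = \<beta>"
    using less_omega1_linear[OF less_omega1_Field(1)[OF *] assms] by blast
next
  assume "\<alpha> \<prec> \<beta> \<or> \<alpha> = \<beta>"
  then show "\<alpha> \<prec> succ_omega1 \<beta>"
    using succ_omega1(2)[OF assms] less_omega1_trans by metis
qed

lemma succ_omega1_inject: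
  "\<alpha> \<in> \<Omega>\<^sub>1 \<Longrightarrow> \<beta> \<in> \<Omega>\<^sub>1 \<Longrightarrow> succ_omega1 \<alpha> = succ_omega1 \<beta> \<Longrightarrow> \<alpha> = \<beta>"
  by (metis less_omega1_irrefl less_omega1_trans less_succ_omega1_iff)

section \<open>One stage of the recursion\<close>

text \<open>\<open>pregap_stage E F f \<alpha> p\<close>: the pair \<open>p\<close> may serve as \<open>(A \<alpha>, B \<alpha>)\<close> after the pairs
  \<open>f \<beta>\<close> with \<open>\<beta> \<prec> \<alpha>\<close>.\<close>

definition pregap_stage ::
  "(nat set \<Rightarrow> nat set) \<Rightarrow> (nat set \<Rightarrow> nat set) \<Rightarrow> (nat set \<Rightarrow> nat set \<times> nat set) \<Rightarrow>
    nat set \<Rightarrow> nat set \<times> nat set \<Rightarrow> bool"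
  where "pregap_stage E F f \<alpha> p \<longleftrightarrow>
    fst p \<subseteq>\<^sup>* snd p \<and>
    (\<forall>\<beta>. \<beta> \<prec> \<alpha> \<longrightarrow> fst (f \<beta>) \<subseteq>\<^sup>* fst p \<and> snd p \<subseteq>\<^sup>* snd (f \<beta>)) \<and>
    (\<forall>\<gamma>\<in>\<Omega>\<^sub>1. \<not> \<gamma> \<prec> \<alpha> \<longrightarrow>
      (\<forall>X\<in>{E \<gamma>, F \<gamma>}. finite (X \<inter> fst p) \<and> X \<subseteq>\<^sup>* snd p)) \<and>
    (\<forall>\<beta>. \<beta> \<prec> \<alpha> \<longrightarrow> succ_omega1 \<beta> = \<alpha> \<longrightarrow>
      p = (fst (f \<beta>) \<union> E \<beta>, snd (f \<beta>) - F \<beta>))"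

text \<open>Each set with a later index meets \<open>E \<beta>\<close> and \<open>F \<beta>\<close>
  in finite sets, so adding the one and removing the other preserves the invariant.\<close>

lemma pregap_stage_successor:
  assumes \<beta>: "\<beta> \<in> \<Omega>\<^sub>1" and stage: "pregap_stage E F f \<beta> (f \<beta>)"
    and disj: "finite (E \<beta> \<inter> F \<beta>)"
      "\<And>\<gamma> X Y. \<gamma> \<in> \<Omega>\<^sub>1 \<Longrightarrow> \<gamma> \<noteq> \<beta> \<Longrightarrow> X \<in> {E \<gamma>, F \<gamma>} \<Longrightarrow> Y \<in> {E \<beta>, F \<beta>} \<Longrightarrow> finite (X \<inter> Y)"
  shows "pregap_stage E F f (succ_omega1 \<beta>) (fst (f \<beta>) \<union> E \<beta>, snd (f \<beta>) - F \<beta>)"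
    (is "pregap_stage E F f ?\<alpha> (?A \<union> E \<beta>, ?B - F \<beta>)")
proof -
  have AB: "?A \<subseteq>\<^sup>* ?B"
    and mono: "\<And>\<delta>. \<delta> \<prec> \<beta> \<Longrightarrow> fst (f \<delta>) \<subseteq>\<^sup>* ?A \<and> ?B \<subseteq>\<^sup>* snd (f \<delta>)"
    and inv: "\<And>\<gamma> X. \<gamma> \<in> \<Omega>\<^sub>1 \<Longrightarrow> \<not> \<gamma> \<prec> \<beta> \<Longrightarrow> X \<in> {E \<gamma>, F \<gamma>} \<Longrightarrow>
      finite (X \<inter> ?A) \<and> X \<subseteq>\<^sup>* ?B"
    using stage unfolding pregap_stage_def by blast+
  have "?A \<union> E \<beta> \<subseteq>\<^sup>* ?B - F \<beta>"
  proof -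
    \<comment> \<open>These four pieces cover all points of \<open>?A\<close> or
      \<open>E \<beta>\<close> that are outside \<open>?B\<close> or in
      \<open>F \<beta>\<close>.\<close>
    have "finite ((?A - ?B) \<union> (F \<beta> \<inter> ?A) \<union> (E \<beta> - ?B) \<union> (E \<beta> \<inter> F \<beta>))"
      using AB inv[OF \<beta> less_omega1_irrefl] disj(1) unfolding almost_subset_def by auto
    then show ?thesis
      unfolding almost_subset_def by (rule rev_finite_subset) auto
  qed
  moreover have "fst (f \<delta>) \<subseteq>\<^sup>* ?A \<union> E \<beta> \<and> ?B - F \<beta> \<subseteq>\<^sup>* snd (f \<delta>)" if "\<delta> \<prec> ?\<alpha>" for \<delta>
  proof -
    have "?A \<subseteq>\<^sup>* ?A \<union> E \<beta>" "?B - F \<beta> \<subseteq>\<^sup>* ?B"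
      by (auto simp: almost_subset_def Diff_eq)
    then show ?thesis
      using that mono less_succ_omega1_iff[OF \<beta>] by (metis almost_subset_trans)
  qed
  moreover have "finite (X \<inter> (?A \<union> E \<beta>)) \<and> X \<subseteq>\<^sup>* ?B - F \<beta>"
    if "\<gamma> \<in> \<Omega>\<^sub>1" "\<not> \<gamma> \<prec> ?\<alpha>" "X \<in> {E \<gamma>, F \<gamma>}" for \<gamma> X
  proof -
    have \<gamma>: "\<not> \<gamma> \<prec> \<beta>" "\<gamma> \<noteq> \<beta>"
      using that(2) less_succ_omega1_iff[OF \<beta>] by auto
    have "finite (X \<inter> E \<beta>)" "finite (X \<inter> F \<beta>)"
      using disj(2)[OF that(1) \<gamma>(2) that(3)] by auto
    moreover have "X - (?B - F \<beta>) = (X - ?B) \<union> (X \<inter> F \<beta>)"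
      by blast
    ultimately show ?thesis
      using inv[OF that(1) \<gamma>(1) that(3)] by (simp add: almost_subset_def Int_Un_distrib)
  qed
  \<comment> \<open>The last clause of \<open>pregap_stage\<close> ranges over all immediate
    predecessors; by injectivity there is only \<open>\<beta>\<close>.\<close>
  moreover have "\<delta> = \<beta>" if "\<delta> \<prec> ?\<alpha>" "succ_omega1 \<delta> = ?\<alpha>" for \<delta>
    using that \<beta> less_omega1_Field(1) succ_omega1_inject by blast
  ultimately show ?thesis
    unfolding pregap_stage_def by auto
qed

text \<open>Covers limits and the least element, where the last clause of
  \<open>pregap_stage\<close> is vacuous. The other clauses come from interpolation;
  \<open>\<X>\<close> collects the sets not yet treated, of which there are fewer than
  \<open>bounding_number\<close>.\<close>

lemma pregap_stage_limit:
  assumes \<alpha>: "\<alpha> \<in> \<Omega>\<^sub>1" and stage: "\<And>\<beta>. \<beta> \<prec> \<alpha> \<Longrightarrow> pregap_stage E F f \<beta> (f \<beta>)"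
    and lim: "\<And>\<beta>. \<beta> \<prec> \<alpha> \<Longrightarrow> succ_omega1 \<beta> \<noteq> \<alpha>"
    and card: "|E ` \<Omega>\<^sub>1 \<union> F ` \<Omega>\<^sub>1| <o bounding_number"
  shows "\<exists>p. pregap_stage E F f \<alpha> p"
proof -
  \<comment> \<open>The pair \<open>({}, UNIV)\<close> makes the family nonempty when \<open>\<alpha>\<close> is the least element.\<close>
  define \<P> where "\<P> = insert ({}, UNIV) (f ` {\<beta>. \<beta> \<prec> \<alpha>})"
  define \<X> where "\<X> = (\<Union>\<gamma>\<in>{\<gamma> \<in> \<Omega>\<^sub>1. \<not> \<gamma> \<prec> \<alpha>}. {E \<gamma>, F \<gamma>})"
  have "|\<P>| \<le>o |UNIV :: nat set|"
  proof -
    have "|f ` {\<beta>. \<beta> \<prec> \<alpha>}| \<le>o |UNIV :: nat set|"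
      using less_omega1_countable[OF \<alpha>] card_of_image ordLeq_transitive by blast
    moreover have "|{({} :: nat set, UNIV :: nat set)}| \<le>o |UNIV :: nat set|"
      by (rule card_of_singl_ordLeq) simp
    moreover have "infinite (Field |UNIV :: nat set| )"
      by (simp add: Field_card_of)
    ultimately have "|{({}, UNIV)} \<union> f ` {\<beta>. \<beta> \<prec> \<alpha>}| \<le>o |UNIV :: nat set|"
      by (intro card_of_Un_ordLeq_infinite_Field card_of_Card_order)
    then show ?thesis
      unfolding \<P>_def by simp
  qed
  then obtain p :: "nat \<Rightarrow> nat set \<times> nat set" where p: "range p = \<P>"
    using card_of_ordLeq2[of \<P> "UNIV :: nat set"] by (metis \<P>_def insert_not_empty)
  have "\<X> \<subseteq> E ` \<Omega>\<^sub>1 \<union> F ` \<Omega>\<^sub>1"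
    unfolding \<X>_def by auto
  then have cardX: "|\<X>| <o bounding_number"
    by (rule ordLeq_ordLess_trans[OF card_of_mono1 card])
  have below: "fst (f \<beta>) \<subseteq>\<^sup>* snd (f \<beta>')" if "\<beta> \<prec> \<alpha>" "\<beta>' \<prec> \<alpha>" for \<beta> \<beta>'
  proof -
    \<comment> \<open>Whichever stage is later, the chain of almost inclusions passes through its
      pair.\<close>
    have "\<beta> \<prec> \<beta>' \<or> \<beta> = \<beta>' \<or> \<beta>' \<prec> \<beta>"
      using that less_omega1_Field(1) less_omega1_linear by blast
    then show ?thesis
      using stage[OF that(1)] stage[OF that(2)] almost_subset_trans
      unfolding pregap_stage_def by blast
  qed
  have "fst q \<subseteq>\<^sup>* snd q'" if "q \<in> \<P>" "q' \<in> \<P>" for q q'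
    using that below unfolding \<P>_def by (auto simp: almost_subset_def)
  then have PQ: "fst (p m) \<subseteq>\<^sup>* snd (p n)" for m n
    using p by blast
  have inv: "finite (X \<inter> fst q) \<and> X \<subseteq>\<^sup>* snd q" if X: "X \<in> \<X>" and q: "q \<in> \<P>" for X q
  proof (cases "q = ({}, UNIV)")
    case True
    then show ?thesis by (simp add: almost_subset_def)
  next
    case False
    then obtain \<beta> where \<beta>: "\<beta> \<prec> \<alpha>" "q = f \<beta>"
      using q unfolding \<P>_def by blast
    obtain \<gamma> where \<gamma>: "\<gamma> \<in> \<Omega>\<^sub>1" "\<not> \<gamma> \<prec> \<alpha>" "X \<in> {E \<gamma>, F \<gamma>}"
      using X unfolding \<X>_def by blast
    have "\<not> \<gamma> \<prec> \<beta>"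
      using \<gamma>(2) \<beta>(1) less_omega1_trans by blast
    then show ?thesis
      using stage[OF \<beta>(1)] \<beta>(2) \<gamma> unfolding pregap_stage_def by blast
  qed
  have inv_p: "finite (X \<inter> fst (p n)) \<and> X \<subseteq>\<^sup>* snd (p n)" if "X \<in> \<X>" for X n
    using inv[OF that] p by blast
  obtain A B where AB: "\<And>n. fst (p n) \<subseteq>\<^sup>* A" "A \<subseteq> B" "\<And>n. B \<subseteq>\<^sup>* snd (p n)"
    "\<And>X. X \<in> \<X> \<Longrightarrow> finite (X \<inter> A)" "\<And>X. X \<in> \<X> \<Longrightarrow> X \<subseteq>\<^sup>* B"
    by (rule bounding_number_interpolation[OF cardX, of "fst \<circ> p" "snd \<circ> p"])
      (use PQ inv_p in auto)
  have "fst (f \<beta>) \<subseteq>\<^sup>* A \<and> B \<subseteq>\<^sup>* snd (f \<beta>)" if "\<beta> \<prec> \<alpha>" for \<beta>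
  proof -
    have "f \<beta> \<in> range p"
      unfolding p \<P>_def using that by blast
    then show ?thesis
      using AB(1,3) by auto
  qed
  moreover have "A \<subseteq>\<^sup>* B"
    using AB(2) by (simp add: almost_subset_def Diff_eq_empty_iff[THEN iffD2])
  moreover have "finite (X \<inter> A) \<and> X \<subseteq>\<^sup>* B"
    if "\<gamma> \<in> \<Omega>\<^sub>1" "\<not> \<gamma> \<prec> \<alpha>" "X \<in> {E \<gamma>, F \<gamma>}" for \<gamma> X
    using that AB(4,5)[of X] unfolding \<X>_def by blast
  ultimately have "pregap_stage E F f \<alpha> (A, B)"
    using lim unfolding pregap_stage_def by auto
  then show ?thesis ..
qed

section \<open>Recursion along \<open>omega1\<close> and the properties of the resulting
  pre-gap\<close>

theorem theorem2p3:
  fixes E F :: "nat set \<Rightarrow> nat set"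
  assumes "omega1 <o bounding_number"
    and "\<And>\<alpha>. \<alpha> \<in> \<Omega>\<^sub>1 \<Longrightarrow> infinite (E \<alpha>)"
    and "\<And>\<alpha>. \<alpha> \<in> \<Omega>\<^sub>1 \<Longrightarrow> infinite (F \<alpha>)"
    and "inj_on E \<Omega>\<^sub>1" and "inj_on F \<Omega>\<^sub>1" and "E ` \<Omega>\<^sub>1 \<inter> F ` \<Omega>\<^sub>1 = {}"
    and "almost_disjoint_family (E ` \<Omega>\<^sub>1 \<union> F ` \<Omega>\<^sub>1)"
  shows "\<exists>A B :: nat set \<Rightarrow> nat set. hausdorff_pregap A B \<and>
    (\<forall>\<alpha>\<in>\<Omega>\<^sub>1.
       E \<alpha> \<subseteq>\<^sup>* A (succ_omega1 \<alpha>) - A \<alpha> \<and> A (succ_omega1 \<alpha>) - A \<alpha> \<subseteq>\<^sup>* E \<alpha> \<and>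
       F \<alpha> \<subseteq>\<^sup>* B \<alpha> - B (succ_omega1 \<alpha>) \<and> B \<alpha> - B (succ_omega1 \<alpha>) \<subseteq>\<^sup>* F \<alpha>)"
proof -
  have "infinite \<Omega>\<^sub>1"
    unfolding omega1_def
    using cardSuc_finite natLeq_Card_order Field_natLeq infinite_UNIV_nat by metis
  then have "|E ` \<Omega>\<^sub>1 \<union> F ` \<Omega>\<^sub>1| \<le>o omega1"
    using card_of_Un_ordLeq_infinite_Field[OF _ card_image_Omega1 card_image_Omega1 Card_order_omega1]
    by blast
  then have card: "|E ` \<Omega>\<^sub>1 \<union> F ` \<Omega>\<^sub>1| <o bounding_number"
    using assms(1) ordLeq_ordLess_trans by blast
  have ad: "finite (X \<inter> Y)"
    if "X \<in> E ` \<Omega>\<^sub>1 \<union> F ` \<Omega>\<^sub>1" "Y \<in> E ` \<Omega>\<^sub>1 \<union> F ` \<Omega>\<^sub>1" "X \<noteq> Y" for X Y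
    using assms(7) that unfolding almost_disjoint_family_def by (simp add: pairwise_def)
  have EF: "E \<alpha> \<noteq> F \<beta>" if "\<alpha> \<in> \<Omega>\<^sub>1" "\<beta> \<in> \<Omega>\<^sub>1" for \<alpha> \<beta>
    using assms(6) that by blast
  have disjEF: "finite (E \<beta> \<inter> F \<beta>)" if "\<beta> \<in> \<Omega>\<^sub>1" for \<beta>
    using that EF[OF that that] by (intro ad) auto
  have disj: "finite (X \<inter> Y)"
    if "\<beta> \<in> \<Omega>\<^sub>1" "\<gamma> \<in> \<Omega>\<^sub>1" "\<gamma> \<noteq> \<beta>" "X \<in> {E \<gamma>, F \<gamma>}" "Y \<in> {E \<beta>, F \<beta>}" for \<beta> \<gamma> X Y
  proof -
    \<comment> \<open>Almost disjointness concerns distinct sets: injectivity separates two members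
      of the same family, and disjointness of the images separates an \<open>E\<close> from an
      \<open>F\<close>.\<close>
    have "X \<noteq> Y"
      using that(3-5) EF[OF that(1,2)] EF[OF that(2,1)] inj_on_eq_iff[OF assms(4) that(2,1)]
        inj_on_eq_iff[OF assms(5) that(2,1)] by fastforce
    then show ?thesis
      using that by (intro ad) auto
  qed
  \<comment> \<open>The condition at \<open>\<alpha>\<close> reads \<open>f\<close> only below
    \<open>\<alpha>\<close>, so well-founded dependent choice applies. The guard exempts elements of
    the carrier type outside the field.\<close>
  have "\<exists>f. \<forall>\<alpha>. \<alpha> \<in> \<Omega>\<^sub>1 \<longrightarrow> pregap_stage E F f \<alpha> (f \<alpha>)"
  proof (rule dependent_wf_choice[OF wf_less_omega1])
    fix f g :: "nat set \<Rightarrow> nat set \<times> nat set" and \<alpha> p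
    assume "\<And>\<beta>. (\<beta>, \<alpha>) \<in> {(\<alpha>, \<beta>). \<alpha> \<prec> \<beta>} \<Longrightarrow> f \<beta> = g \<beta>"
    then show "(\<alpha> \<in> \<Omega>\<^sub>1 \<longrightarrow> pregap_stage E F f \<alpha> p) = (\<alpha> \<in> \<Omega>\<^sub>1 \<longrightarrow> pregap_stage E F g \<alpha> p)"
      unfolding pregap_stage_def by simp
  next
    fix \<alpha> and f :: "nat set \<Rightarrow> nat set \<times> nat set"
    assume "\<And>\<beta>. (\<beta>, \<alpha>) \<in> {(\<alpha>, \<beta>). \<alpha> \<prec> \<beta>} \<Longrightarrow> \<beta> \<in> \<Omega>\<^sub>1 \<longrightarrow> pregap_stage E F f \<beta> (f \<beta>)"
    then have IH: "\<And>\<beta>. \<beta> \<prec> \<alpha> \<Longrightarrow> pregap_stage E F f \<beta> (f \<beta>)"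
      using less_omega1_Field(1) by blast
    show "\<exists>p. \<alpha> \<in> \<Omega>\<^sub>1 \<longrightarrow> pregap_stage E F f \<alpha> p"
    proof (cases "\<exists>\<beta>. \<beta> \<prec> \<alpha> \<and> succ_omega1 \<beta> = \<alpha>")
      case True
      then obtain \<beta> where \<beta>: "\<beta> \<prec> \<alpha>" "succ_omega1 \<beta> = \<alpha>" by blast
      have \<beta>': "\<beta> \<in> \<Omega>\<^sub>1"
        using \<beta>(1) by (rule less_omega1_Field)
      have "pregap_stage E F f \<alpha> (fst (f \<beta>) \<union> E \<beta>, snd (f \<beta>) - F \<beta>)"
        unfolding \<beta>(2)[symmetric]
        by (rule pregap_stage_successor[OF \<beta>' IH[OF \<beta>(1)] disjEF[OF \<beta>']]) (rule disj[OF \<beta>'])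
      then show ?thesis by blast
    next
      case False
      then show ?thesis
        using pregap_stage_limit[OF _ IH _ card] by blast
    qed
  qed
  then obtain f where f: "\<And>\<alpha>. \<alpha> \<in> \<Omega>\<^sub>1 \<Longrightarrow> pregap_stage E F f \<alpha> (f \<alpha>)"
    by blast
  define A where "A = fst \<circ> f"
  define B where "B = snd \<circ> f"
  have AB: "A \<alpha> \<subseteq>\<^sup>* B \<alpha>" if "\<alpha> \<in> \<Omega>\<^sub>1" for \<alpha>
    using f[OF that] unfolding pregap_stage_def A_def B_def by simp
  have mono: "A \<alpha> \<subseteq>\<^sup>* A \<beta>" "B \<beta> \<subseteq>\<^sup>* B \<alpha>" if "\<alpha> \<prec> \<beta>" for \<alpha> \<beta>
    using f[OF less_omega1_Field(2)[OF that]] that unfolding pregap_stage_def A_def B_def by auto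
  have inv: "finite (E \<alpha> \<inter> A \<alpha>)" "finite (F \<alpha> \<inter> A \<alpha>)" "finite (F \<alpha> - B \<alpha>)"
    if "\<alpha> \<in> \<Omega>\<^sub>1" for \<alpha>
    using f[OF that] that less_omega1_irrefl
    unfolding pregap_stage_def A_def B_def almost_subset_def by auto
  have succ: "A (succ_omega1 \<alpha>) = A \<alpha> \<union> E \<alpha>" "B (succ_omega1 \<alpha>) = B \<alpha> - F \<alpha>"
    if "\<alpha> \<in> \<Omega>\<^sub>1" for \<alpha>
  proof -
    have "f (succ_omega1 \<alpha>) = (fst (f \<alpha>) \<union> E \<alpha>, snd (f \<alpha>) - F \<alpha>)"
      using f[OF succ_omega1(1)[OF that]] succ_omega1(2)[OF that]
      unfolding pregap_stage_def by blast
    then show "A (succ_omega1 \<alpha>) = A \<alpha> \<union> E \<alpha>" "B (succ_omega1 \<alpha>) = B \<alpha> - F \<alpha>"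
      unfolding A_def B_def by simp_all
  qed
  \<comment> \<open>The successor of \<open>\<alpha>\<close> already adds the infinite set
    \<open>E \<alpha>\<close>, which almost misses \<open>A \<alpha>\<close>, and
    \<open>A \<beta>\<close> almost contains that stage.\<close>
  have strictA: "\<not> A \<beta> \<subseteq>\<^sup>* A \<alpha>" if "\<alpha> \<prec> \<beta>" for \<alpha> \<beta>
  proof
    have \<alpha>: "\<alpha> \<in> \<Omega>\<^sub>1" using that by (rule less_omega1_Field)
    assume "A \<beta> \<subseteq>\<^sup>* A \<alpha>"
    then have "A (succ_omega1 \<alpha>) \<subseteq>\<^sup>* A \<alpha>"
      using succ_omega1(3)[OF \<alpha> that] mono(1) almost_subset_trans by blast
    then have "finite (E \<alpha> - A \<alpha>)"
      by (simp add: succ(1)[OF \<alpha>] almost_subset_def Un_Diff)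
    then show False
      using inv(1)[OF \<alpha>] assms(2)[OF \<alpha>] by (metis Un_Diff_Int finite_Un)
  qed
  \<comment> \<open>Dually, the successor stage removes \<open>F \<alpha>\<close>, which is infinite
    and almost inside \<open>B \<alpha>\<close>.\<close>
  have strictB: "\<not> B \<alpha> \<subseteq>\<^sup>* B \<beta>" if "\<alpha> \<prec> \<beta>" for \<alpha> \<beta>
  proof
    have \<alpha>: "\<alpha> \<in> \<Omega>\<^sub>1" using that by (rule less_omega1_Field)
    assume "B \<alpha> \<subseteq>\<^sup>* B \<beta>"
    then have "B \<alpha> \<subseteq>\<^sup>* B (succ_omega1 \<alpha>)"
      using succ_omega1(3)[OF \<alpha> that] mono(2) almost_subset_trans by blast
    then have "finite (F \<alpha> \<inter> B \<alpha>)"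
      by (simp add: succ(2)[OF \<alpha>] almost_subset_def Diff_Diff_Int Int_commute)
    then show False
      using inv(3)[OF \<alpha>] assms(3)[OF \<alpha>] by (metis Un_Diff_Int finite_Un)
  qed
  \<comment> \<open>The infinite set \<open>F \<alpha>\<close> is almost inside
    \<open>B \<alpha>\<close> and almost misses \<open>A \<alpha>\<close>.\<close>
  have strictAB: "\<not> B \<alpha> \<subseteq>\<^sup>* A \<alpha>" if \<alpha>: "\<alpha> \<in> \<Omega>\<^sub>1" for \<alpha>
  proof
    assume "B \<alpha> \<subseteq>\<^sup>* A \<alpha>"
    then have "finite ((F \<alpha> - B \<alpha>) \<union> (B \<alpha> - A \<alpha>) \<union> (F \<alpha> \<inter> A \<alpha>))"
      using inv[OF \<alpha>] by (simp add: almost_subset_def)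
    then have "finite (F \<alpha>)"
      by (rule rev_finite_subset) blast
    then show False
      using assms(3)[OF \<alpha>] by blast
  qed
  have "hausdorff_pregap A B"
    unfolding hausdorff_pregap_def almost_psubset_def
    using AB mono strictA strictB strictAB by blast
  moreover have "E \<alpha> \<subseteq>\<^sup>* A (succ_omega1 \<alpha>) - A \<alpha> \<and> A (succ_omega1 \<alpha>) - A \<alpha> \<subseteq>\<^sup>* E \<alpha> \<and>
       F \<alpha> \<subseteq>\<^sup>* B \<alpha> - B (succ_omega1 \<alpha>) \<and> B \<alpha> - B (succ_omega1 \<alpha>) \<subseteq>\<^sup>* F \<alpha>"
    if \<alpha>: "\<alpha> \<in> \<Omega>\<^sub>1" for \<alpha>
  proof -
    \<comment> \<open>After rewriting with \<open>succ\<close>, one inclusion of each pair is exact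
      and the other has a finite error by \<open>inv\<close>.\<close>
    have "E \<alpha> - (A \<alpha> \<union> E \<alpha> - A \<alpha>) = E \<alpha> \<inter> A \<alpha>" "A \<alpha> \<union> E \<alpha> - A \<alpha> - E \<alpha> = {}"
      "F \<alpha> - (B \<alpha> - (B \<alpha> - F \<alpha>)) = F \<alpha> - B \<alpha>" "B \<alpha> - (B \<alpha> - F \<alpha>) - F \<alpha> = {}"
      by blast+
    then show ?thesis
      using inv[OF \<alpha>] unfolding almost_subset_def succ[OF \<alpha>] by (metis finite.emptyI)
  qed
  ultimately show ?thesis by blast
qed

end
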